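(* Let $n,p\ge1$. A tensor $\mathcal{H}\in\mathbb{C}^{2n\times2n\times p}$ is T-Hamiltonian if and only if each of its Fourier-domain slices $\widehat{\boldsymbol{H}}^{(i)}$, $i=1,\dots,p$, is a Hamiltonian matrix.
   Context: A tensor $\mathcal{A}\in\mathbb{C}^{m\times n\times p}$ has frontal slices $\boldsymbol{A}^{(1)},\dots,\boldsymbol{A}^{(p)}\in\mathbb{C}^{m\times n}$. With $\omega=e^{2\pi\sqrt{-1}/p}$, its Fourier-domain slices are $\widehat{\boldsymbol{A}}^{(i)}=\sum_{j=1}^{p}\omega^{(i-1)(j-1)}\boldsymbol{A}^{(j)}$, $i=1,\dots,p$. Let $\operatorname{bcirc}(\mathcal{A})\in\mathbb{C}^{mp\times np}$ be the block circulant matrix whose $(r,s)$ block is $\boldsymbol{A}^{(((r-s)\bmod p)+1)}$. The T-product $\mathcal{A}*\mathcal{B}$ is the tensor with $\operatorname{bcirc}(\mathcal{A}*\mathcal{B})=\operatorname{bcirc}(\mathcal{A})\operatorname{bcirc}(\mathcal{B})$; equivalently, if $\mathcal{C}=\mathcal{A}*\mathcal{B}$ then $\widehat{\boldsymbol{C}}^{(i)}=\widehat{\boldsymbol{A}}^{(i)}\widehat{\boldsymbol{B}}^{(i)}$ for all $i$. The T-conjugate transpose $\mathcal{A}^H$ has frontal slices $(\boldsymbol{A}^{(1)})^H$ for $k=1$ and $(\boldsymbol{A}^{(p-k+2)})^H$ for $k\ge2$ (so that $\operatorname{bcirc}(\mathcal{A}^H)=\operatorname{bcirc}(\mathcal{A})^H$).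 Let $\boldsymbol{J}=\begin{bmatrix}\boldsymbol{0}&\boldsymbol{I}_n\\-\boldsymbol{I}_n&\boldsymbol{0}\end{bmatrix}$. The T-symplectic unit tensor $\mathcal{J}\in\mathbb{R}^{2n\times2n\times p}$ is the tensor all of whose Fourier-domain slices equal $\boldsymbol{J}$. A matrix $\boldsymbol{H}\in\mathbb{C}^{2n\times2n}$ is Hamiltonian if $(\boldsymbol{J}\boldsymbol{H})^H=\boldsymbol{J}\boldsymbol{H}$ (conjugate transpose). A tensor $\mathcal{H}\in\mathbb{C}^{2n\times2n\times p}$ is T-Hamiltonian if $(\mathcal{J}*\mathcal{H})^H=\mathcal{J}*\mathcal{H}$. *)

theory Defs
  imports "HOL-Analysis.Analysis" "Jordan_Normal_Form.Schur_Decomposition"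
begin

(* A third-order tensor is the list of its frontal slices; all slice numbers below are 1-based. *)

type_synonym tensor = "complex mat list"

definition tensor_carrier :: "nat \<Rightarrow> nat \<Rightarrow> nat \<Rightarrow> tensor set" where
  "tensor_carrier m n p = {A. length A = p \<and> set A \<subseteq> carrier_mat m n}"

definition slice :: "tensor \<Rightarrow> nat \<Rightarrow> complex mat" where
  "slice A k = A ! (k - 1)"

(* Meaningful for nonempty tensors only. *)
definition trows :: "tensor \<Rightarrow> nat" where
  "trows A = dim_row (slice A 1)"

definition tcols :: "tensor \<Rightarrow> nat" where
  "tcols A = dim_col (slice A 1)"

definition omega :: "nat \<Rightarrow> complex" where
  "omega p = exp (2 * of_real pi * \<i> / of_nat p)"

(* The linear combination of slices is taken entrywise, since matrices of unspecified
   dimension do not form an additive monoid. *)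
definition fourier_slice :: "tensor \<Rightarrow> nat \<Rightarrow> complex mat" where
  "fourier_slice A i = mat (trows A) (tcols A)
     (\<lambda>(a, b). \<Sum>j = 1..length A. omega (length A) ^ ((i - 1) * (j - 1)) * slice A j $$ (a, b))"

(* The entry at (x, y) lies in the block (r, s) with r - s = x div m - y div n. *)
definition bcirc :: "tensor \<Rightarrow> complex mat" where
  "bcirc A = (let m = trows A; n = tcols A; p = length A in
     mat (m * p) (n * p) (\<lambda>(x, y).
       slice A (nat ((int (x div m) - int (y div n)) mod int p) + 1) $$ (x mod m, y mod n)))"

definition tprod :: "tensor \<Rightarrow> tensor \<Rightarrow> tensor" where
  "tprod A B = (THE C. C \<in> tensor_carrier (trows A) (tcols B) (length A) \<and>
     bcirc C = bcirc A * bcirc B)"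

definition tadjoint :: "tensor \<Rightarrow> tensor" where
  "tadjoint A = map (\<lambda>k. mat_adjoint (if k = 1 then slice A 1 else slice A (length A + 2 - k)))
     [1..<length A + 1]"

definition J_mat :: "nat \<Rightarrow> complex mat" where
  "J_mat n = four_block_mat (0\<^sub>m n n) (1\<^sub>m n) (- 1\<^sub>m n) (0\<^sub>m n n)"

definition J_tensor :: "nat \<Rightarrow> nat \<Rightarrow> tensor" where
  "J_tensor n p = (THE T. T \<in> tensor_carrier (2 * n) (2 * n) p \<and>
     (\<forall>i\<in>{1..p}. fourier_slice T i = J_mat n))"

definition hamiltonian :: "nat \<Rightarrow> complex mat \<Rightarrow> bool" where
  "hamiltonian n H \<longleftrightarrow> H \<in> carrier_mat (2 * n) (2 * n) \<and>
     mat_adjoint (J_mat n * H) = J_mat n * H"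

definition T_hamiltonian :: "nat \<Rightarrow> nat \<Rightarrow> tensor \<Rightarrow> bool" where
  "T_hamiltonian n p H \<longleftrightarrow> H \<in> tensor_carrier (2 * n) (2 * n) p \<and>
     tadjoint (tprod (J_tensor n p) H) = tprod (J_tensor n p) H"

section \<open>The descriptions defining the T-product and the T-symplectic unit are proper\<close>

lemma tensor_carrierD:
  assumes "A \<in> tensor_carrier m n p" "p \<ge> 1"
  shows "length A = p" "trows A = m" "tcols A = n" "k < p \<Longrightarrow> A ! k \<in> carrier_mat m n"
proof -
  show len: "length A = p" using assms by (simp add: tensor_carrier_def)
  show car: "A ! k \<in> carrier_mat m n" if "k < p" for k
    using assms(1) that len nth_mem[of k A] by (auto simp: tensor_carrier_def)
  from car[of 0] assms(2) show "trows A = m" "tcols A = n"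
    by (auto simp: trows_def tcols_def slice_def)
qed

lemma tensor_eqI:
  assumes A: "A \<in> tensor_carrier m n p" and B: "B \<in> tensor_carrier m n p" and p: "p \<ge> 1"
    and eq: "\<And>k a b. k < p \<Longrightarrow> a < m \<Longrightarrow> b < n \<Longrightarrow> A ! k $$ (a, b) = B ! k $$ (a, b)"
  shows "A = B"
proof (rule nth_equalityI)
  show "length A = length B" using tensor_carrierD[OF A p] tensor_carrierD[OF B p] by simp
next
  fix k assume "k < length A"
  hence k: "k < p" using tensor_carrierD[OF A p] by simp
  have "A ! k \<in> carrier_mat m n" "B ! k \<in> carrier_mat m n"
    using k tensor_carrierD(4)[OF A p] tensor_carrierD(4)[OF B p] by auto
  with eq[OF k] show "A ! k = B ! k" by (intro eq_matI) auto
qed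

lemma bcirc_index:
  assumes A: "A \<in> tensor_carrier m n p" and p: "p \<ge> 1" and "x < m * p" "y < n * p"
  shows "bcirc A $$ (x, y) =
    A ! nat ((int (x div m) - int (y div n)) mod int p) $$ (x mod m, y mod n)"
  using assms tensor_carrierD[OF A p] by (simp add: bcirc_def Let_def slice_def)

lemma bcirc_carrier:
  assumes A: "A \<in> tensor_carrier m n p" and p: "p \<ge> 1"
  shows "bcirc A \<in> carrier_mat (m * p) (n * p)"
  using tensor_carrierD[OF A p] by (simp add: bcirc_def Let_def)

lemma bcirc_inj:
  assumes A: "A \<in> tensor_carrier m n p" and B: "B \<in> tensor_carrier m n p" and p: "p \<ge> 1"
    and eq: "bcirc A = bcirc B"
  shows "A = B"
proof (rule tensor_eqI[OF A B p])
  fix k a b assume k: "k < p" and a: "a < m" and b: "b < n"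
  have "m * k + a < m * (k + 1)" using a by simp
  also have "\<dots> \<le> m * p" using k by (intro mult_le_mono) auto
  finally have x: "m * k + a < m * p" .
  have "n * 1 \<le> n * p" using p by (intro mult_le_mono) auto
  hence y: "b < n * p" using b by linarith
  have [simp]: "(m * k + a) div m = k" using a by simp
  have [simp]: "a mod m = a" "b div n = 0" "b mod n = b" using a b by auto
  have [simp]: "nat (int k mod int p) = k" using k by simp
  show "A ! k $$ (a, b) = B ! k $$ (a, b)"
    using bcirc_index[OF A p x y] bcirc_index[OF B p x y] eq by simp
qed

lemma sum_block_index:
  fixes f :: "nat \<Rightarrow> nat \<Rightarrow> complex"
  shows "(\<Sum>t\<in>{0..<n * p}. f (t div n) (t mod n)) = (\<Sum>u<p. \<Sum>c<n. f u c)"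
proof -
  have "(\<Sum>u<p. \<Sum>c<n. f u c) = (\<Sum>(u, c)\<in>{..<p} \<times> {..<n}. f u c)"
    by (simp add: sum.cartesian_product)
  also have "\<dots> = (\<Sum>t\<in>{0..<n * p}. f (t div n) (t mod n))"
  proof (rule sum.reindex_bij_witness[where j = "\<lambda>(u, c). n * u + c" and i = "\<lambda>t. (t div n, t mod n)"])
    fix z assume "z \<in> {..<p} \<times> {..<n}"
    then obtain u c where z: "z = (u, c)" "u < p" "c < n" by auto
    have "n * u + c < n * (u + 1)" using z by simp
    also have "\<dots> \<le> n * p" using z by (intro mult_le_mono) auto
    finally show "(case z of (u, c) \<Rightarrow> n * u + c) \<in> {0..<n * p}" using z by simp
  next
    fix t assume t: "t \<in> {0..<n * p}"
    hence "n > 0" by (cases n) auto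
    thus "(t div n, t mod n) \<in> {..<p} \<times> {..<n}"
      using t by (auto simp: less_mult_imp_div_less mult.commute)
  qed auto
  finally show ?thesis ..
qed

lemma sum_cyclic_shift:
  fixes f :: "nat \<Rightarrow> complex"
  assumes p: "p \<ge> 1"
  shows "(\<Sum>u<p. f u) = (\<Sum>j<p. f (nat ((int j + s) mod int p)))"
proof (rule sum.reindex_bij_witness[where j = "\<lambda>u. nat ((int u - s) mod int p)"
      and i = "\<lambda>j. nat ((int j + s) mod int p)"])
  fix a assume "a \<in> {..<p}"
  thus "nat ((int (nat ((int a - s) mod int p)) + s) mod int p) = a"
    using p by (simp add: mod_simps)
  thus "f (nat ((int (nat ((int a - s) mod int p)) + s) mod int p)) = f a" by simp
  show "nat ((int a - s) mod int p) \<in> {..<p}" using p by (simp add: nat_less_iff)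
next
  fix a assume "a \<in> {..<p}"
  thus "nat ((int (nat ((int a + s) mod int p)) - s) mod int p) = a"
    using p by (simp add: mod_simps)
  show "nat ((int a + s) mod int p) \<in> {..<p}" using p by (simp add: nat_less_iff)
qed

lemma tprod_exists:
  assumes A: "A \<in> tensor_carrier m n p" and B: "B \<in> tensor_carrier n l p" and p: "p \<ge> 1"
  shows "\<exists>C. C \<in> tensor_carrier m l p \<and> bcirc C = bcirc A * bcirc B"
proof -
  define C where "C = map (\<lambda>k. mat m l (\<lambda>(a, b).
    \<Sum>j<p. \<Sum>c<n. A ! nat ((int k - int j) mod int p) $$ (a, c) * B ! j $$ (c, b))) [0..<p]"
  have C: "C \<in> tensor_carrier m l p" by (auto simp: C_def tensor_carrier_def)
  note cA = bcirc_carrier[OF A p] and cB = bcirc_carrier[OF B p] and cC = bcirc_carrier[OF C p]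
  have "bcirc C = bcirc A * bcirc B"
  proof (rule eq_matI)
    fix x y assume "x < dim_row (bcirc A * bcirc B)" "y < dim_col (bcirc A * bcirc B)"
    hence x: "x < m * p" and y: "y < l * p" using cA cB by auto
    have m: "m > 0" using x by (cases m) auto
    have l: "l > 0" using y by (cases l) auto
    define r s where "r = int (x div m)" and "s = int (y div l)"
    define g where "g u c = A ! nat ((r - int u) mod int p) $$ (x mod m, c) *
      B ! nat ((int u - s) mod int p) $$ (c, y mod l)" for u c
    have k: "nat ((r - s) mod int p) < p" using p by (simp add: nat_less_iff)
    have "(bcirc A * bcirc B) $$ (x, y) =
        (\<Sum>t\<in>{0..<n * p}. bcirc A $$ (x, t) * bcirc B $$ (t, y))"
      using x y cA cB by (simp add: scalar_prod_def)
    also have "\<dots> = (\<Sum>t\<in>{0..<n * p}. g (t div n) (t mod n))"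
      by (intro sum.cong refl)
        (simp add: bcirc_index[OF A p x] bcirc_index[OF B p _ y] g_def r_def s_def)
    also have "\<dots> = (\<Sum>u<p. \<Sum>c<n. g u c)" by (rule sum_block_index)
    also have "\<dots> = (\<Sum>j<p. \<Sum>c<n. g (nat ((int j + s) mod int p)) c)"
      by (rule sum_cyclic_shift[OF p])
    also have "\<dots> = (\<Sum>j<p. \<Sum>c<n. A ! nat ((int (nat ((r - s) mod int p)) - int j) mod int p)
        $$ (x mod m, c) * B ! j $$ (c, y mod l))"
    proof (intro sum.cong refl)
      fix j c assume "j \<in> {..<p}"
      hence "(int j + s - s) mod int p = int j" by simp
      moreover have e: "r - (int j + s) = r - s - int j" by simp
      ultimately show "g (nat ((int j + s) mod int p)) c =
          A ! nat ((int (nat ((r - s) mod int p)) - int j) mod int p) $$ (x mod m, c) *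
          B ! j $$ (c, y mod l)"
        using p unfolding g_def by (simp add: mod_diff_left_eq mod_diff_right_eq e)
    qed
    also have "\<dots> = bcirc C $$ (x, y)"
      using k m l unfolding bcirc_index[OF C p x y] r_def[symmetric] s_def[symmetric]
      by (simp add: C_def)
    finally show "bcirc C $$ (x, y) = (bcirc A * bcirc B) $$ (x, y)" ..
  qed (use cA cB cC in auto)
  with C show ?thesis by blast
qed

lemma tprod_spec:
  assumes A: "A \<in> tensor_carrier m n p" and B: "B \<in> tensor_carrier n l p" and p: "p \<ge> 1"
  shows "tprod A B \<in> tensor_carrier m l p" "bcirc (tprod A B) = bcirc A * bcirc B"
proof -
  have "\<exists>!C. C \<in> tensor_carrier (trows A) (tcols B) (length A) \<and> bcirc C = bcirc A * bcirc B"
    unfolding tensor_carrierD(1,2)[OF A p] tensor_carrierD(3)[OF B p]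
  proof (rule ex_ex1I[OF tprod_exists[OF A B p]])
    fix C D
    assume "C \<in> tensor_carrier m l p \<and> bcirc C = bcirc A * bcirc B"
      and "D \<in> tensor_carrier m l p \<and> bcirc D = bcirc A * bcirc B"
    thus "C = D" by (intro bcirc_inj[of C m l p D] p) auto
  qed
  from theI'[OF this] show "tprod A B \<in> tensor_carrier m l p" "bcirc (tprod A B) = bcirc A * bcirc B"
    using tensor_carrierD[OF A p] tensor_carrierD[OF B p] by (auto simp: tprod_def)
qed

lemma sum_omega:
  assumes p: "p \<ge> 1" and j: "j < p" and k: "k < p"
  shows "(\<Sum>i<p. omega p ^ (i * j) / omega p ^ (i * k)) = (if j = k then of_nat p else 0)"
proof -
  define w where "w = omega p ^ j / omega p ^ k"
  have nz: "omega p \<noteq> 0" by (simp add: omega_def)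
  have s: "(\<Sum>i<p. omega p ^ (i * j) / omega p ^ (i * k)) = (\<Sum>i<p. w ^ i)"
    by (simp add: w_def power_divide flip: power_mult) (simp add: mult.commute)
  show ?thesis
  proof (cases "j = k")
    case True
    thus ?thesis using nz by (simp add: s w_def)
  next
    case False
    have pow: "omega p ^ q = exp (2 * of_real pi * \<i> * of_nat q / of_nat p)" for q
      unfolding omega_def exp_of_nat_mult[symmetric] by (rule arg_cong[of _ _ exp]) simp
    have "omega p ^ p = 1" using p complex_root_unity_eq_1[of p p] by (simp add: pow)
    hence "w ^ p = 1"
      by (metis w_def power_divide power_mult mult.commute power_one div_by_1)
    moreover have "w \<noteq> 1"
    proof
      assume "w = 1"
      hence "omega p ^ j = omega p ^ k" using nz by (simp add: w_def)
      hence "j mod p = k mod p"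
        unfolding pow complex_root_unity_eq[OF p] .
      thus False using j k False by simp
    qed
    ultimately show ?thesis using False by (simp add: s geometric_sum)
  qed
qed

lemma fourier_slice_index:
  assumes A: "A \<in> tensor_carrier m n p" and p: "p \<ge> 1" and "a < m" "b < n"
  shows "fourier_slice A (Suc i) $$ (a, b) = (\<Sum>j<p. omega p ^ (i * j) * A ! j $$ (a, b))"
proof -
  have "(\<Sum>j = 1..p. omega p ^ (i * (j - 1)) * A ! (j - 1) $$ (a, b)) =
        (\<Sum>j<p. omega p ^ (i * j) * A ! j $$ (a, b))"
    by (intro sum.reindex_bij_witness[where j = "\<lambda>j. j - 1" and i = Suc]) auto
  thus ?thesis using assms tensor_carrierD[OF A p] by (simp add: fourier_slice_def slice_def)
qed

lemma fourier_slice_inj: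
  assumes A: "A \<in> tensor_carrier m n p" and B: "B \<in> tensor_carrier m n p" and p: "p \<ge> 1"
    and eq: "\<And>i. i \<in> {1..p} \<Longrightarrow> fourier_slice A i = fourier_slice B i"
  shows "A = B"
proof (rule tensor_eqI[OF A B p])
  fix k a b assume k: "k < p" and a: "a < m" and b: "b < n"
  have inv: "of_nat p * T ! k $$ (a, b) =
      (\<Sum>i<p. fourier_slice T (Suc i) $$ (a, b) / omega p ^ (i * k))"
    if T: "T \<in> tensor_carrier m n p" for T
  proof -
    have "(\<Sum>i<p. fourier_slice T (Suc i) $$ (a, b) / omega p ^ (i * k)) =
        (\<Sum>i<p. \<Sum>j<p. omega p ^ (i * j) / omega p ^ (i * k) * T ! j $$ (a, b))"
      by (simp add: fourier_slice_index[OF T p a b] sum_divide_distrib)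
    also have "\<dots> = (\<Sum>j<p. (\<Sum>i<p. omega p ^ (i * j) / omega p ^ (i * k)) * T ! j $$ (a, b))"
      by (subst sum.swap) (simp add: sum_distrib_right)
    also have "\<dots> = (\<Sum>j<p. if j = k then of_nat p * T ! j $$ (a, b) else 0)"
      using k by (intro sum.cong refl) (simp add: sum_omega[OF p])
    also have "\<dots> = of_nat p * T ! k $$ (a, b)" using k by simp
    finally show ?thesis ..
  qed
  have "of_nat p * A ! k $$ (a, b) = of_nat p * B ! k $$ (a, b)"
    unfolding inv[OF A] inv[OF B] by (intro sum.cong refl) (simp add: eq)
  thus "A ! k $$ (a, b) = B ! k $$ (a, b)" using p by simp
qed

lemma J_mat_carrier: "J_mat n \<in> carrier_mat (2 * n) (2 * n)"
  by (simp add: J_mat_def mult_2)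

lemma J_tensor_ex1:
  assumes p: "p \<ge> 1"
  shows "\<exists>!T. T \<in> tensor_carrier (2 * n) (2 * n) p \<and>
    (\<forall>i\<in>{1..p}. fourier_slice T i = J_mat n)"
proof -
  let ?T = "J_mat n # replicate (p - 1) (0\<^sub>m (2 * n) (2 * n))"
  have T: "?T \<in> tensor_carrier (2 * n) (2 * n) p"
    using p J_mat_carrier by (auto simp: tensor_carrier_def)
  have F: "fourier_slice ?T i = J_mat n" if "i \<in> {1..p}" for i
  proof (rule eq_matI)
    fix a b assume "a < dim_row (J_mat n)" "b < dim_col (J_mat n)"
    hence ab: "a < 2 * n" "b < 2 * n" using J_mat_carrier[of n] by auto
    from that obtain i' where i: "i = Suc i'" by (cases i) auto
    have "fourier_slice ?T i $$ (a, b) = (\<Sum>j<p. omega p ^ (i' * j) * ?T ! j $$ (a, b))"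
      unfolding i by (rule fourier_slice_index[OF T p ab])
    also have "\<dots> = (\<Sum>j<p. if j = 0 then J_mat n $$ (a, b) else 0)"
      using ab by (intro sum.cong refl) (auto simp: nth_Cons' )
    also have "\<dots> = J_mat n $$ (a, b)" using p by simp
    finally show "fourier_slice ?T i $$ (a, b) = J_mat n $$ (a, b)" .
  qed (use tensor_carrierD[OF T p] J_mat_carrier[of n] in \<open>auto simp: fourier_slice_def\<close>)
  show ?thesis
  proof (rule ex1I[of _ ?T])
    fix S assume "S \<in> tensor_carrier (2 * n) (2 * n) p \<and>
      (\<forall>i\<in>{1..p}. fourier_slice S i = J_mat n)"
    thus "S = ?T" using F by (intro fourier_slice_inj[OF _ T p]) metis+
  qed (use T F in blast)
qed

lemma J_tensor_spec:
  assumes p: "p \<ge> 1"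
  shows "J_tensor n p \<in> tensor_carrier (2 * n) (2 * n) p"
    and "i \<in> {1..p} \<Longrightarrow> fourier_slice (J_tensor n p) i = J_mat n"
  using theI'[OF J_tensor_ex1[OF p, of n]] by (auto simp: J_tensor_def)

end

theory Submission
  imports Defs
begin

text \<open>The discrete Fourier transform along the third mode turns the T-product into slicewise
  matrix products and the T-conjugate transpose into slicewise conjugate transposes. As it is
  injective and maps the T-symplectic unit to the constant family \<open>J\<close>, the equation
  \<open>(J * H)\<^sup>H = J * H\<close> holds for tensors iff it holds in each Fourier slice.\<close>

lemma mat_adjoint_dim [simp]:
  fixes A :: "'a :: conjugatable_field mat"
  shows "dim_row (mat_adjoint A) = dim_col A" "dim_col (mat_adjoint A) = dim_row A"
  by (simp_all add: mat_adjoint_def)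

lemma mat_adjoint_index:
  fixes A :: "'a :: conjugatable_field mat"
  assumes "a < dim_col A" "b < dim_row A"
  shows "mat_adjoint A $$ (a, b) = conjugate (A $$ (b, a))"
  using assms by (simp add: mat_adjoint_def mat_of_rows_def)

lemma omega_power_self:
  assumes "p \<ge> 1"
  shows "omega p ^ p = 1"
proof -
  have "omega p ^ p = exp (of_nat p * (2 * of_real pi * \<i> / of_nat p))"
    unfolding omega_def by (rule exp_of_nat_mult[symmetric])
  also have "\<dots> = exp (2 * of_real pi * \<i>)" using assms by simp
  finally show ?thesis by simp
qed

text \<open>Since \<open>omega p\<close> is a \<open>p\<close>-th root of unity, its exponents
  matter only modulo \<open>p\<close>. This lets cyclic index arithmetic on slices pass into
  exponents.\<close>

lemma omega_power_cong:
  assumes p: "p \<ge> 1" and "q mod p = q' mod p"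
  shows "omega p ^ q = omega p ^ q'"
proof -
  have "omega p ^ q = omega p ^ (q mod p)" for q
  proof -
    have "omega p ^ q = omega p ^ (p * (q div p) + q mod p)" by simp
    also have "\<dots> = omega p ^ (q mod p)"
      unfolding power_add power_mult omega_power_self[OF p] by simp
    finally show ?thesis .
  qed
  with assms(2) show ?thesis by metis
qed

lemma cnj_omega: "cnj (omega p) = inverse (omega p)"
  by (simp add: omega_def exp_cnj exp_minus[symmetric])

text \<open>Cyclic indices are formed over the integers, where subtraction does not truncate. These
  facts turn them back into valid list positions.\<close>

lemma nat_int_mod:
  assumes "p \<ge> 1"
  shows "nat (x mod int p) < p" "int (nat (x mod int p)) = x mod int p"
  using assms by (simp_all add: nat_less_iff)

text \<open>\<open>tprod\<close> is known only through \<open>bcirc\<close>, but the first block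
  column of a block circulant matrix lists the slices. Reading off that column of the matrix product
  gives a cyclic convolution.\<close>

lemma tprod_nth:
  assumes A: "A \<in> tensor_carrier m n p" and B: "B \<in> tensor_carrier n l p" and p: "p \<ge> 1"
    and k: "k < p" and a: "a < m" and b: "b < l"
  shows "tprod A B ! k $$ (a, b) =
    (\<Sum>u<p. \<Sum>c<n. A ! nat ((int k - int u) mod int p) $$ (a, c) * B ! u $$ (c, b))"
proof -
  note C = tprod_spec[OF A B p]
  have "m * k + a < m * (k + 1)" using a by simp
  also have "\<dots> \<le> m * p" using k by (intro mult_le_mono) auto
  finally have x: "m * k + a < m * p" .
  have "l * 1 \<le> l * p" using p by (intro mult_le_mono) auto
  hence y: "b < l * p" using b by linarith
  have [simp]: "(m * k + a) div m = k" "a mod m = a" "b div l = 0" "b mod l = b"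
    using a b by auto
  \<comment> \<open>The reduction of \<open>u\<close> modulo \<open>p\<close> copies the form
    produced by \<open>bcirc_index\<close> for block \<open>(u, 0)\<close>; it disappears once
    \<open>u < p\<close> is known.\<close>
  define g where "g u c = A ! nat ((int k - int u) mod int p) $$ (a, c) * B ! nat (int u mod int p) $$ (c, b)"
    for u c
  have "tprod A B ! k $$ (a, b) = bcirc (tprod A B) $$ (m * k + a, b)"
    using k by (simp add: bcirc_index[OF C(1) p x y])
  also have "\<dots> = (\<Sum>t\<in>{0..<n * p}. bcirc A $$ (m * k + a, t) * bcirc B $$ (t, b))"
    using x y bcirc_carrier[OF A p] bcirc_carrier[OF B p] by (simp add: C(2) scalar_prod_def)
  also have "\<dots> = (\<Sum>t\<in>{0..<n * p}. g (t div n) (t mod n))"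
    by (intro sum.cong refl) (simp add: bcirc_index[OF A p x] bcirc_index[OF B p _ y] g_def)
  also have "\<dots> = (\<Sum>u<p. \<Sum>c<n. g u c)" by (rule sum_block_index)
  also have "\<dots> = (\<Sum>u<p. \<Sum>c<n. A ! nat ((int k - int u) mod int p) $$ (a, c) * B ! u $$ (c, b))"
    by (intro sum.cong refl) (simp add: g_def)
  finally show ?thesis .
qed

lemma fourier_slice_carrier:
  assumes "A \<in> tensor_carrier m n p" "p \<ge> 1"
  shows "fourier_slice A i \<in> carrier_mat m n"
  using tensor_carrierD[OF assms] by (simp add: fourier_slice_def)

text \<open>This is the convolution theorem, with slices as matrix-valued coefficients: the discrete
  Fourier transform turns the cyclic convolution of \<open>tprod_nth\<close> into products.\<close>

lemma fourier_slice_tprod: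
  assumes A: "A \<in> tensor_carrier m n p" and B: "B \<in> tensor_carrier n l p" and p: "p \<ge> 1"
    and "i \<ge> 1"
  shows "fourier_slice (tprod A B) i = fourier_slice A i * fourier_slice B i"
proof -
  obtain i' where i: "i = Suc i'" using \<open>i \<ge> 1\<close> by (cases i) auto
  note C = tprod_spec(1)[OF A B p]
  note cA = fourier_slice_carrier[OF A p, of i] and cB = fourier_slice_carrier[OF B p, of i]
    and cC = fourier_slice_carrier[OF C p, of i]
  show ?thesis
  proof (rule eq_matI)
    fix a b assume "a < dim_row (fourier_slice A i * fourier_slice B i)"
      and "b < dim_col (fourier_slice A i * fourier_slice B i)"
    hence a: "a < m" and b: "b < l" using cA cB by auto
    let ?A = "\<lambda>k u c. A ! nat ((int k - int u) mod int p) $$ (a, c)"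
    \<comment> \<open>For fixed \<open>u\<close>, the substitution \<open>k = (j + u) mod p\<close>
      undoes the shift of the slice index and splits off the factor
      \<open>omega p ^ (i' * u)\<close>, which is later absorbed by the Fourier sum of
      \<open>B\<close>.\<close>
    have shift: "(\<Sum>k<p. omega p ^ (i' * k) * ?A k u c) =
        omega p ^ (i' * u) * fourier_slice A i $$ (a, c)" if c: "c < n" for u c
    proof -
      have "(\<Sum>k<p. omega p ^ (i' * k) * ?A k u c) =
          (\<Sum>j<p. omega p ^ (i' * nat ((int j + int u) mod int p)) *
            ?A (nat ((int j + int u) mod int p)) u c)"
        by (rule sum_cyclic_shift[OF p])
      also have "\<dots> = (\<Sum>j<p. omega p ^ (i' * u) * (omega p ^ (i' * j) * A ! j $$ (a, c)))"
      proof (intro sum.cong refl)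
        fix j assume j: "j \<in> {..<p}"
        have e: "nat ((int j + int u) mod int p) = (j + u) mod p"
          by (simp flip: of_nat_add zmod_int)
        have "omega p ^ (i' * ((j + u) mod p)) = omega p ^ (i' * (j + u))"
          by (rule omega_power_cong[OF p]) (simp add: mod_mult_right_eq)
        moreover have "(int ((j + u) mod p) - int u) mod int p = int j"
          using j by (simp add: zmod_int mod_diff_left_eq)
        ultimately show "omega p ^ (i' * nat ((int j + int u) mod int p)) *
            ?A (nat ((int j + int u) mod int p)) u c =
            omega p ^ (i' * u) * (omega p ^ (i' * j) * A ! j $$ (a, c))"
          unfolding e by (simp add: distrib_left power_add)
      qed
      also have "\<dots> = omega p ^ (i' * u) * fourier_slice A i $$ (a, c)"
        by (simp add: i fourier_slice_index[OF A p a c] sum_distrib_left)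
      finally show ?thesis .
    qed
    have "fourier_slice (tprod A B) i $$ (a, b) =
        (\<Sum>k<p. \<Sum>u<p. \<Sum>c<n. omega p ^ (i' * k) * ?A k u c * B ! u $$ (c, b))"
      by (simp add: i fourier_slice_index[OF C p a b] tprod_nth[OF A B p _ a b]
          sum_distrib_left mult.assoc)
    \<comment> \<open>Two exchanges move the sum over \<open>k\<close> innermost, where
      \<open>shift\<close> evaluates it.\<close>
    also have "\<dots> = (\<Sum>u<p. \<Sum>k<p. \<Sum>c<n. omega p ^ (i' * k) * ?A k u c * B ! u $$ (c, b))"
      by (rule sum.swap)
    also have "\<dots> = (\<Sum>u<p. \<Sum>c<n. \<Sum>k<p. omega p ^ (i' * k) * ?A k u c * B ! u $$ (c, b))"
      by (intro sum.cong refl sum.swap)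
    also have "\<dots> = (\<Sum>u<p. \<Sum>c<n.
        fourier_slice A i $$ (a, c) * (omega p ^ (i' * u) * B ! u $$ (c, b)))"
      by (intro sum.cong refl) (simp add: shift flip: sum_distrib_right)
    also have "\<dots> = (\<Sum>c<n. \<Sum>u<p.
        fourier_slice A i $$ (a, c) * (omega p ^ (i' * u) * B ! u $$ (c, b)))"
      by (rule sum.swap)
    also have "\<dots> = (\<Sum>c<n. fourier_slice A i $$ (a, c) * fourier_slice B i $$ (c, b))"
      by (intro sum.cong refl) (simp add: i fourier_slice_index[OF B p _ b] sum_distrib_left)
    also have "\<dots> = (fourier_slice A i * fourier_slice B i) $$ (a, b)"
      using a b cA cB by (simp add: scalar_prod_def atLeast0LessThan)
    finally show "fourier_slice (tprod A B) i $$ (a, b) =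
        (fourier_slice A i * fourier_slice B i) $$ (a, b)" .
  qed (use cA cB cC in auto)
qed

text \<open>With positions counted from 0, both cases of the definition become negation modulo the
  length: position 0 is fixed, and any other \<open>k\<close> goes to
  \<open>length A - k\<close>.\<close>

lemma tadjoint_nth:
  assumes "k < length A"
  shows "tadjoint A ! k = mat_adjoint (A ! nat ((- int k) mod int (length A)))"
proof (cases "k = 0")
  case False
  with assms have "(- int k) mod int (length A) = int (length A - k)"
    by (subst zmod_zminus1_eq_if) (auto simp: of_nat_diff)
  hence "nat ((- int k) mod int (length A)) = length A - k" by (simp only: nat_int)
  with False assms show ?thesis by (simp add: tadjoint_def slice_def del: upt_Suc)
qed (use assms in \<open>simp add: tadjoint_def slice_def del: upt_Suc\<close>)

lemma tadjoint_carrier: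
  assumes A: "A \<in> tensor_carrier m n p" and p: "p \<ge> 1"
  shows "tadjoint A \<in> tensor_carrier n m p"
proof -
  note D = tensor_carrierD[OF A p]
  have "tadjoint A ! k \<in> carrier_mat n m" if "k < p" for k
    using that D(4)[of "nat ((- int k) mod int p)"] nat_int_mod[OF p]
    by (intro carrier_matI) (auto simp: tadjoint_nth D(1))
  moreover have "length (tadjoint A) = p" using D(1) by (simp add: tadjoint_def)
  ultimately show ?thesis by (auto simp: tensor_carrier_def set_conv_nth)
qed

text \<open>Negating the slice index modulo \<open>p\<close> inverts the powers of
  \<open>omega p\<close>, and on the unit circle inversion is conjugation. The Fourier sum of the
  adjoint slices is therefore the conjugate of the original sum, with entries transposed.\<close>

lemma fourier_slice_tadjoint:
  assumes A: "A \<in> tensor_carrier m n p" and p: "p \<ge> 1" and "i \<ge> 1"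
  shows "fourier_slice (tadjoint A) i = mat_adjoint (fourier_slice A i)"
proof -
  obtain i' where i: "i = Suc i'" using \<open>i \<ge> 1\<close> by (cases i) auto
  note T = tadjoint_carrier[OF A p]
  note cA = fourier_slice_carrier[OF A p, of i] and cT = fourier_slice_carrier[OF T p, of i]
  let ?neg = "\<lambda>k. nat ((- int k) mod int p)"
  have neg: "?neg k < p" "int (?neg k) = (- int k) mod int p" for k
    using nat_int_mod[OF p] by auto
  have negneg: "?neg (?neg k) = k" if "k < p" for k
    using that by (simp only: neg(2) mod_minus_eq) simp
  \<comment> \<open>The two exponents add up to a multiple of \<open>p\<close>, so the powers are
    mutually inverse; \<open>cnj_omega\<close> then identifies the inverse with the
    conjugate.\<close>
  have omega_neg: "omega p ^ (i' * ?neg j) = cnj (omega p ^ (i' * j))" for j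
  proof -
    have "int ((?neg j + j) mod p) = 0"
      by (simp only: zmod_int of_nat_add neg(2) mod_add_left_eq) simp
    hence "(i' * ?neg j + i' * j) mod p = 0 mod p"
      by (metis distrib_left mod_mult_right_eq mult_0_right of_nat_eq_0_iff)
    from omega_power_cong[OF p this]
    have "omega p ^ (i' * ?neg j) * omega p ^ (i' * j) = 1" by (simp add: power_add)
    from inverse_unique[OF this[unfolded mult.commute[of "omega p ^ (i' * ?neg j)"]]]
    show ?thesis by (simp add: cnj_omega power_inverse)
  qed
  show ?thesis
  proof (rule eq_matI)
    fix a b assume "a < dim_row (mat_adjoint (fourier_slice A i))"
      and "b < dim_col (mat_adjoint (fourier_slice A i))"
    hence a: "a < n" and b: "b < m" using cA by auto
    have "fourier_slice (tadjoint A) i $$ (a, b) =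
        (\<Sum>k<p. omega p ^ (i' * k) * tadjoint A ! k $$ (a, b))"
      unfolding i by (rule fourier_slice_index[OF T p a b])
    also have "\<dots> = (\<Sum>k<p. omega p ^ (i' * k) * cnj (A ! ?neg k $$ (b, a)))"
    proof (intro sum.cong refl arg_cong2[where f = "(*)"])
      fix k assume "k \<in> {..<p}"
      thus "tadjoint A ! k $$ (a, b) = cnj (A ! ?neg k $$ (b, a))"
        using tensor_carrierD(1)[OF A p] tensor_carrierD(4)[OF A p neg(1)[of k]] a b
        by (simp add: tadjoint_nth mat_adjoint_index)
    qed
    \<comment> \<open>By \<open>negneg\<close>, index negation is an involution of the positions
      below \<open>p\<close>, so it serves as its own inverse in the reindexing.\<close>
    also have "\<dots> = (\<Sum>j<p. omega p ^ (i' * ?neg j) * cnj (A ! j $$ (b, a)))"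
      by (rule sum.reindex_bij_witness[where i = ?neg and j = ?neg]) (use neg(1) negneg in auto)
    also have "\<dots> = cnj (fourier_slice A i $$ (b, a))"
      by (simp add: i fourier_slice_index[OF A p b a] omega_neg)
    also have "\<dots> = mat_adjoint (fourier_slice A i) $$ (a, b)"
      using a b cA by (simp add: mat_adjoint_index)
    finally show "fourier_slice (tadjoint A) i $$ (a, b) =
        mat_adjoint (fourier_slice A i) $$ (a, b)" .
  qed (use cA cT in auto)
qed

theorem theorem3p4:
  fixes n p :: nat and H :: tensor
  assumes "n \<ge> 1" and "p \<ge> 1"
    and "H \<in> tensor_carrier (2 * n) (2 * n) p"
  shows "T_hamiltonian n p H \<longleftrightarrow> (\<forall>i\<in>{1..p}. hamiltonian n (fourier_slice H i))"
proof -
  note p = assms(2) and H = assms(3)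
  note J = J_tensor_spec[OF p, where n = n]
  let ?K = "tprod (J_tensor n p) H"
  note K = tprod_spec(1)[OF J(1) H p]
  have FK: "fourier_slice ?K i = J_mat n * fourier_slice H i" if "i \<in> {1..p}" for i
    using that fourier_slice_tprod[OF J(1) H p, of i] J(2)[OF that] by simp
  have FT: "fourier_slice (tadjoint ?K) i = mat_adjoint (J_mat n * fourier_slice H i)"
    if "i \<in> {1..p}" for i
    using that fourier_slice_tadjoint[OF K p, of i] FK by simp
  \<comment> \<open>Both sides are tensors of the same square format, so
    \<open>fourier_slice_inj\<close> applies and the tensor equation can be tested slice by
    slice.\<close>
  have "tadjoint ?K = ?K \<longleftrightarrow>
      (\<forall>i\<in>{1..p}. fourier_slice (tadjoint ?K) i = fourier_slice ?K i)"
    using fourier_slice_inj[OF tadjoint_carrier[OF K p] K p] by auto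
  \<comment> \<open>The carrier conditions hold on both sides, which leaves exactly the slicewise
    equations rewritten by \<open>FK\<close> and \<open>FT\<close>.\<close>
  thus ?thesis
    using H fourier_slice_carrier[OF H p] by (simp add: T_hamiltonian_def hamiltonian_def FK FT)
qed

end
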